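(* Let $\mu$ be the self-similar measure described in the context. Then there exists a constant $C>0$ such that for all $n$, all $p$, all $I\in\mathcal{F}_n$ and all $J\in\mathcal{F}_p$, $$C^{-1}\mu(I)\mu(J)\le \mu\left(I\cap\sigma^{-(n+1)}(J)\right)\le C\,\mu(I)\,\mu\left(\sigma^{-2}(J)\right).$$
   Context: Let $\ell\ge 2$ be an integer. For $0\le i\le \ell-1$ define $S_i,S_{i+\ell}:[0,1]\to[0,1]$ by $S_i(x)=\frac{x}{\ell}+\frac{i}{\ell}$ and $S_{i+\ell}(x)=-\frac{x}{\ell}+\frac{i+1}{\ell}$. Let $(p_i)_{0\le i\le 2\ell-1}$ be a probability weight ($p_i\ge 0$, $\sum_i p_i=1$) with $p_i+p_{i+\ell}>0$ for every $0\le i\le \ell-1$ (equivalently, $\mu$ has support $[0,1]$). Let $\mu$ be the unique Borel probability measure on $[0,1]$ with $\mu=\sum_{i=0}^{2\ell-1}p_i\,\mu\circ S_i^{-1}$. $\mathcal{F}_n$ is the set of $\ell$-adic intervals $[k/\ell^n,(k+1)/\ell^n)$, $0\le k<\ell^n$, of generation $n$. The map $\sigma:[0,1]\to[0,1]$ is the shift $\sigma(x)=\ell x \pmod 1$.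
   Formalization: Added hypothesis: some p_i with 0≤i≤ℓ-1 is positive, or p_{i+ℓ}=p_{(ℓ-1-i)+ℓ} for all 0≤i≤ℓ-1. Without it the claim fails: for ℓ=2, p_0=p_1=0, p_2≠p_3, n=0, J with digits 0,1,0,1,… gives p_2^p against p_3^p. Only failing cases are excluded. *)

theory Defs
  imports "HOL-Probability.Probability"
begin

text \<open>Only the values at \<open>i < 2 * l\<close> and \<open>x \<in> {0..1}\<close> matter.\<close>

definition S :: "nat \<Rightarrow> nat \<Rightarrow> real \<Rightarrow> real" where
  "S l i x = (if i < l then x / real l + real i / real l
              else - x / real l + real (i - l + 1) / real l)"

text \<open>The measure lives on the Borel subsets of \<open>{0..1}\<close>, so that \<open>space M = {0..1}\<close> and
  preimages under \<open>S l i\<close> are taken inside \<open>{0..1}\<close>.\<close>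

definition self_similar_measure :: "nat \<Rightarrow> (nat \<Rightarrow> real) \<Rightarrow> real measure \<Rightarrow> bool" where
  "self_similar_measure l p M \<longleftrightarrow>
     prob_space M \<and> sets M = sets (restrict_space borel {0..1}) \<and>
     (\<forall>A \<in> sets M. measure M A = (\<Sum>i<2 * l. p i * measure M (S l i -` A \<inter> space M)))"

definition ladic_intervals :: "nat \<Rightarrow> nat \<Rightarrow> real set set" where
  "ladic_intervals l n = {{real k / real l ^ n ..< real (k + 1) / real l ^ n} | k. k < l ^ n}"

text \<open>In particular the endpoint \<open>1\<close> is sent to \<open>0\<close>.\<close>

definition shift :: "nat \<Rightarrow> real \<Rightarrow> real" where
  "shift l x = frac (real l * x)"

definition shift_preimage :: "nat \<Rightarrow> nat \<Rightarrow> real set \<Rightarrow> real set" where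
  "shift_preimage l n J = (shift l ^^ n) -` J \<inter> {0..1}"

end

theory Submission
  imports Defs
begin

text \<open>Let \<open>R x = 1 - x\<close>. Since \<open>S l (i + l) = S l i \<circ> R\<close>, zooming into an \<open>l\<close>-adic interval
  of generation \<open>1\<close> turns the pair \<open>(\<mu>, \<mu> \<circ> R)\<close> into a nonnegative linear image of itself.
  Iterating over the digits of an interval \<open>I\<close> of generation \<open>n\<close>, one obtains nonnegative
  \<open>a\<close>, \<open>b\<close> with \<open>a + b = \<mu> I\<close> such that \<open>\<mu>\<close>, restricted to \<open>I\<close> and rescaled to the unit
  interval, is \<open>a \<mu> + b (\<mu> \<circ> R)\<close> (lemmas \<open>cylinder_matrix\<close> and \<open>measure_ladic\<close>). This uses that \<open>0\<close> and \<open>1\<close> are not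
  atoms (lemma \<open>endpoints_null\<close>), so that common endpoints of adjacent intervals do not matter.

  Let \<open>P\<close> and \<open>Q = 1 - P\<close> be the total weights of the orientation preserving and reversing maps.
  The shift inverts every branch up to orientation, so
  \<open>\<mu> (\<sigma>\<^sup>-\<^sup>1 A) = P \<mu> A + Q \<mu> (R A)\<close> (lemma \<open>measure_shift_preimage\<close>), and altogether
  \<open>\<mu> (I \<inter> \<sigma>\<^sup>-\<^sup>(\<^sup>n\<^sup>+\<^sup>1\<^sup>) J) = a (P \<mu> J + Q \<mu> (R J)) + b (P \<mu> (R J) + Q \<mu> J)\<close>, whereas
  \<open>\<mu> (\<sigma>\<^sup>-\<^sup>2 J) = (P\<^sup>2 + Q\<^sup>2) \<mu> J + 2 P Q \<mu> (R J)\<close>.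

  If \<open>P\<close> and \<open>Q\<close> are positive, both bounds hold with \<open>C = 1 / (P Q)\<close>: the extra digit between
  \<open>I\<close> and \<open>J\<close> mixes the two orientations. If \<open>Q = 0\<close>, then \<open>b = 0\<close> and both bounds are equalities
  with \<open>C = 1\<close>. If \<open>P = 0\<close>, the weights are assumed to be symmetric, hence \<open>\<mu> (R J) = \<mu> J\<close>, and
  again both bounds are equalities with \<open>C = 1\<close>.\<close>

section \<open>The shift and its preimages\<close>

lemma frac_add_of_nat [simp]: "frac (x + real k) = frac x"
  by (rule frac_add_int_right) simp

lemma frac_of_nat_mult_frac: "frac (real l * frac x) = frac (real l * x)"
proof -
  have "real l * x = real l * frac x + of_int (int l * \<lfloor>x\<rfloor>)"
    by (simp add: frac_def algebra_simps)
  then show ?thesis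
    by (metis frac_add_of_int_right)
qed

lemma shift_funpow_Suc: "(shift l ^^ Suc n) x = frac (real l ^ Suc n * x)"
proof (induction n)
  case (Suc n)
  have "(shift l ^^ Suc (Suc n)) x = shift l ((shift l ^^ Suc n) x)"
    by simp
  also have "\<dots> = frac (real l * (real l ^ Suc n * x))"
    by (simp only: Suc.IH shift_def frac_of_nat_mult_frac)
  finally show ?case
    by (simp add: mult_ac)
qed (simp add: shift_def)

lemma shift_preimage_borel:
  assumes "A \<in> sets borel"
  shows "shift_preimage l n A \<in> sets borel"
proof -
  have meas: "shift l \<in> borel_measurable borel"
    unfolding shift_def frac_def by measurable
  have "(shift l ^^ n) \<in> borel_measurable borel"
    by (rule measurable_compose_n[OF meas])
  from measurable_sets[OF this assms] show ?thesis
    by (auto simp: shift_preimage_def)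
qed

lemma shift_preimage_2:
  "shift_preimage l 2 A = shift_preimage l 1 (shift_preimage l 1 A)"
  by (auto simp: shift_preimage_def shift_def numeral_2_eq_2 frac_ge_0 less_imp_le[OF frac_lt_1])


section \<open>Rescaling and reflection\<close>

text \<open>The \<open>k\<close>-th \<open>l\<close>-adic interval of generation \<open>n\<close>, with both endpoints. Unlike the half-open
  intervals, the closed ones of a given generation are permuted by \<open>R\<close>.\<close>

definition closed_ladic :: "nat \<Rightarrow> nat \<Rightarrow> nat \<Rightarrow> real set" where
  "closed_ladic l n k = {real k / real l ^ n .. (real k + 1) / real l ^ n}"

text \<open>The part of \<open>A\<close> in the \<open>k\<close>-th interval of generation \<open>n\<close>, rescaled to the unit interval
  with its orientation preserved.\<close>

definition zoom :: "nat \<Rightarrow> nat \<Rightarrow> nat \<Rightarrow> real set \<Rightarrow> real set" where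
  "zoom l n k A = (\<lambda>x. (x + real k) / real l ^ n) -` A \<inter> {0..1}"

text \<open>The mirror image in the unit interval.\<close>

definition mirror :: "real set \<Rightarrow> real set" where
  "mirror A = (\<lambda>x. 1 - x) -` A \<inter> {0..1}"

lemma mem_zoom: "x \<in> zoom l n k A \<longleftrightarrow> (x + real k) / real l ^ n \<in> A \<and> 0 \<le> x \<and> x \<le> 1"
  by (auto simp: zoom_def)

lemma mem_mirror: "x \<in> mirror A \<longleftrightarrow> 1 - x \<in> A \<and> 0 \<le> x \<and> x \<le> 1"
  by (auto simp: mirror_def)

lemma zoom_borel: "A \<in> sets borel \<Longrightarrow> zoom l n k A \<in> sets borel"
proof -
  assume A: "A \<in> sets borel"
  have "(\<lambda>x. (x + real k) / real l ^ n) \<in> borel_measurable borel"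
    by measurable
  from measurable_sets[OF this A] show ?thesis
    by (auto simp: zoom_def)
qed

lemma mirror_borel: "A \<in> sets borel \<Longrightarrow> mirror A \<in> sets borel"
proof -
  assume A: "A \<in> sets borel"
  have "(\<lambda>x::real. 1 - x) \<in> borel_measurable borel"
    by measurable
  from measurable_sets[OF this A] show ?thesis
    by (auto simp: mirror_def)
qed

lemma zoom_subset: "zoom l n k A \<subseteq> {0..1}"
  and mirror_subset: "mirror A \<subseteq> {0..1}"
  and shift_preimage_subset: "shift_preimage l n A \<subseteq> {0..1}"
  by (auto simp: zoom_def mirror_def shift_preimage_def)

lemma mirror_mirror: "A \<subseteq> {0..1} \<Longrightarrow> mirror (mirror A) = A"
  by (auto simp: mirror_def)

lemma zoom_0_0: "A \<subseteq> {0..1} \<Longrightarrow> zoom l 0 0 A = A"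
  by (auto simp: zoom_def)

lemma zoom_Suc:
  assumes "0 < l"
  shows "zoom l 1 (k mod l) (zoom l n (k div l) A) = zoom l (Suc n) k A"
proof -
  have k: "real k = real l * real (k div l) + real (k mod l)"
    by (metis mult_div_mod_eq of_nat_add of_nat_mult)
  have i: "real (k mod l) + 1 \<le> real l"
    using assms by (metis Suc_leI add.commute mod_less_divisor of_nat_Suc of_nat_le_iff)
  have "((x + real (k mod l)) / real l + real (k div l)) / real l ^ n
      = (x + real k) / real l ^ Suc n" for x
    using assms by (simp add: k field_simps)
  moreover have "0 \<le> (x + real (k mod l)) / real l \<and> (x + real (k mod l)) / real l \<le> 1"
    if "0 \<le> x" "x \<le> 1" for x
    using that i assms by (simp add: field_simps)
  ultimately show ?thesis
    by (auto simp: mem_zoom)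
qed

lemma zoom_mirror:
  assumes "i < l"
  shows "zoom l 1 (l - 1 - i) (mirror A) = mirror (zoom l 1 i A)"
proof -
  have r: "real (l - 1 - i) = real l - 1 - real i"
    using assms by (simp add: of_nat_diff)
  have i: "real i + 1 \<le> real l"
    using assms by linarith
  have "1 - (x + real (l - 1 - i)) / real l = (1 - x + real i) / real l" for x
    using assms by (simp add: r field_simps)
  moreover have "0 \<le> (x + real (l - 1 - i)) / real l \<and> (x + real (l - 1 - i)) / real l \<le> 1"
    if "0 \<le> x" "x \<le> 1" for x
    using that i assms by (simp add: r field_simps)
  ultimately show ?thesis
    by (auto simp: mem_zoom mem_mirror)
qed

lemma closed_ladic_Suc_subset:
  assumes "0 < l"
  shows "closed_ladic l (Suc n) k \<subseteq> closed_ladic l n (k div l)"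
    and "A \<subseteq> closed_ladic l (Suc n) k \<Longrightarrow> zoom l n (k div l) A \<subseteq> closed_ladic l 1 (k mod l)"
proof -
  have k: "real k = real l * real (k div l) + real (k mod l)"
    by (metis mult_div_mod_eq of_nat_add of_nat_mult)
  have i: "real (k mod l) + 1 \<le> real l"
    using assms by (metis Suc_leI add.commute mod_less_divisor of_nat_Suc of_nat_le_iff)
  have l: "0 < real l" "0 < real l ^ n"
    using assms by auto
  have "real (k div l) / real l ^ n \<le> real k / real l ^ Suc n"
    using l by (simp add: k field_simps)
  moreover have "(real k + 1) / real l ^ Suc n \<le> (real (k div l) + 1) / real l ^ n"
  proof -
    have "(real k + 1) / real l ^ Suc n \<le> (real l * (real (k div l) + 1)) / real l ^ Suc n"
      using i l by (intro divide_right_mono) (auto simp: k algebra_simps)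
    also have "\<dots> = (real (k div l) + 1) / real l ^ n"
      using l by simp
    finally show ?thesis .
  qed
  ultimately show "closed_ladic l (Suc n) k \<subseteq> closed_ladic l n (k div l)"
    by (auto simp: closed_ladic_def)
  show "zoom l n (k div l) A \<subseteq> closed_ladic l 1 (k mod l)" if A: "A \<subseteq> closed_ladic l (Suc n) k"
  proof
    fix x assume "x \<in> zoom l n (k div l) A"
    then have "(x + real (k div l)) / real l ^ n \<in> closed_ladic l (Suc n) k"
      using A by (auto simp: mem_zoom)
    moreover have "(x + real (k div l)) / real l ^ n
        = (real l * x + real l * real (k div l)) / real l ^ Suc n"
      using l by (simp add: field_simps)
    ultimately have "real k \<le> real l * x + real l * real (k div l)"
      "real l * x + real l * real (k div l) \<le> real k + 1"
      using l by (simp_all add: closed_ladic_def divide_le_cancel del: power_Suc)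
    then show "x \<in> closed_ladic l 1 (k mod l)"
      using l by (simp add: closed_ladic_def k field_simps)
  qed
qed

lemma mirror_closed_ladic:
  assumes "i < l" and "A \<subseteq> closed_ladic l 1 i"
  shows "mirror A \<subseteq> closed_ladic l 1 (l - 1 - i)"
proof
  fix x assume "x \<in> mirror A"
  then have "1 - x \<in> closed_ladic l 1 i"
    using assms(2) by (auto simp: mem_mirror)
  moreover have "real (l - 1 - i) = real l - 1 - real i"
    using assms by (simp add: of_nat_diff)
  ultimately show "x \<in> closed_ladic l 1 (l - 1 - i)"
    using assms(1) by (simp add: closed_ladic_def field_simps)
qed

lemma ladic_subset_unit:
  assumes "0 < l" and "k < l ^ n"
  shows "{real k / real l ^ n ..< real (k + 1) / real l ^ n} \<subseteq> {0..1}"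
proof -
  have "real (k + 1) \<le> real (l ^ n)"
    using assms by (metis Suc_eq_plus1 Suc_leI of_nat_le_iff)
  then have "real (k + 1) / real l ^ n \<le> 1"
    using assms by simp
  moreover have "0 \<le> real k / real l ^ n"
    by simp
  ultimately show ?thesis
    by (meson atLeastAtMost_iff atLeastLessThan_iff less_imp_le order_trans subsetI)
qed

section \<open>Self-similar measures\<close>

text \<open>The standing assumptions on the weights and the measure, without the condition on the
  orientation.\<close>

locale ladic_self_similar =
  fixes l :: nat and p :: "nat \<Rightarrow> real" and M :: "real measure"
  assumes l: "2 \<le> l"
    and p_nonneg: "i < 2 * l \<Longrightarrow> 0 \<le> p i"
    and p_sum: "(\<Sum>i<2 * l. p i) = 1"
    and p_pos: "i < l \<Longrightarrow> 0 < p i + p (i + l)"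
    and M: "self_similar_measure l p M"
begin

lemma prob: "prob_space M" and sets_M: "sets M = sets (restrict_space borel {0..1})"
  using M by (auto simp: self_similar_measure_def)

sublocale prob_space M
  by (rule prob)

lemma space_M: "space M = {0..1}"
  using sets_eq_imp_space_eq[OF sets_M] by (simp add: space_restrict_space)

lemma in_sets_M: "A \<in> sets M \<longleftrightarrow> A \<in> sets borel \<and> A \<subseteq> {0..1}"
  by (auto simp: sets_M sets_restrict_space_iff)

lemma zoom_in_sets [simp]: "A \<in> sets M \<Longrightarrow> zoom l n k A \<in> sets M"
  and mirror_in_sets [simp]: "A \<in> sets M \<Longrightarrow> mirror A \<in> sets M"
  and shift_preimage_in_sets [simp]: "A \<in> sets M \<Longrightarrow> shift_preimage l n A \<in> sets M"
  by (auto simp: in_sets_M zoom_borel mirror_borel shift_preimage_borel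
      dest: subsetD[OF zoom_subset] subsetD[OF mirror_subset] subsetD[OF shift_preimage_subset])

lemma sum_double: "(\<Sum>i<2 * l. f i) = (\<Sum>i<l. f i) + (\<Sum>i<l. f (i + l))"
  for f :: "nat \<Rightarrow> real"
  using sum.atLeastLessThan_concat[of 0 l "l + l" f] sum.shift_bounds_nat_ivl[of f 0 l l]
  by (simp add: atLeast0LessThan mult_2)

lemma measure_eq_sum_zoom:
  assumes "A \<in> sets M"
  shows "measure M A = (\<Sum>i<l. p i * measure M (zoom l 1 i A)
           + p (i + l) * measure M (mirror (zoom l 1 i A)))"
proof -
  have "measure M A = (\<Sum>i<2 * l. p i * measure M (S l i -` A \<inter> space M))"
    using M assms by (simp add: self_similar_measure_def)
  also have "\<dots> = (\<Sum>i<l. p i * measure M (S l i -` A \<inter> space M))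
      + (\<Sum>i<l. p (i + l) * measure M (S l (i + l) -` A \<inter> space M))"
    by (rule sum_double)
  also have "\<dots> = (\<Sum>i<l. p i * measure M (zoom l 1 i A))
      + (\<Sum>i<l. p (i + l) * measure M (mirror (zoom l 1 i A)))"
  proof -
    have "S l i -` A \<inter> space M = zoom l 1 i A"
      "S l (i + l) -` A \<inter> space M = mirror (zoom l 1 i A)" if "i < l" for i
      using that by (auto simp: space_M S_def zoom_def mirror_def add_divide_distrib
          diff_divide_distrib algebra_simps)
    then show ?thesis
      by simp
  qed
  finally show ?thesis
    by (simp add: sum.distrib)
qed

lemma weight_less_1:
  assumes "i < l"
  shows "p i + p (i + l) < 1"
proof -
  \<comment> \<open>any second index, whose weight is positive as well\<close>
  define j where "j = (if i = 0 then 1 else 0 :: nat)"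
  have j: "j < l" "j \<noteq> i"
    using l by (auto simp: j_def)
  have "(\<Sum>k\<in>{i, j}. p k + p (k + l)) \<le> (\<Sum>k<l. p k + p (k + l))"
    using assms j by (intro sum_mono2) (auto intro: less_imp_le p_pos)
  also have "\<dots> = 1"
    using p_sum by (simp add: sum_double sum.distrib)
  finally show ?thesis
    using j p_pos[of j] by (simp add: add_ac)
qed

text \<open>The preimages of an endpoint under the maps \<open>S l i\<close> are endpoints, and only the two maps onto
  the outermost interval at that endpoint contribute. Hence the mass of each endpoint is at most
  the larger one of the two masses times a factor less than \<open>1\<close>, so both masses vanish.\<close>

lemma endpoints_null: "measure M {0} = 0" "measure M {1} = 0"
proof -
  let ?u = "measure M {0}" and ?v = "measure M {1}"
  have in_sets: "{0} \<in> sets M" "{1} \<in> sets M"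
    by (auto simp: in_sets_M)
  have mirrors: "mirror {0} = {1}" "mirror {1} = {0}" "mirror {} = {}"
    by (auto simp: mirror_def)
  have z0: "zoom l 1 i {0} = (if i = 0 then {0} else {})" for i
    using l by (auto simp: zoom_def)
  have z1: "zoom l 1 i {1} = (if i = l - 1 then {1} else {})" if "i < l" for i
  proof -
    have *: "x + real i = real l \<longleftrightarrow> x = 1 \<and> i = l - 1" if "0 \<le> x" "x \<le> 1" for x
      using that \<open>i < l\<close> by (auto simp: of_nat_diff)
    have "x \<in> zoom l 1 i {1} \<longleftrightarrow> 0 \<le> x \<and> x \<le> 1 \<and> x + real i = real l" for x
      using l by (auto simp: mem_zoom)
    then have "x \<in> zoom l 1 i {1} \<longleftrightarrow> x = 1 \<and> i = l - 1" for x
      using * by auto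
    then show ?thesis
      by auto
  qed
  have "?u = (\<Sum>i<l. if i = 0 then p 0 * ?u + p l * ?v else 0)"
    using measure_eq_sum_zoom[OF in_sets(1)]
    by (subst (asm) sum.cong[OF refl, where h = "\<lambda>i. if i = 0 then p 0 * ?u + p l * ?v else 0"])
      (auto simp: z0 mirrors simp del: One_nat_def)
  then have u: "?u = p 0 * ?u + p l * ?v"
    using l by simp
  have "?v = (\<Sum>i<l. if i = l - 1 then p (l - 1) * ?v + p (l - 1 + l) * ?u else 0)"
    using measure_eq_sum_zoom[OF in_sets(2)]
    by (subst (asm) sum.cong[OF refl,
          where h = "\<lambda>i. if i = l - 1 then p (l - 1) * ?v + p (l - 1 + l) * ?u else 0"])
      (auto simp: z1 mirrors simp del: One_nat_def)
  then have v: "?v = p (l - 1) * ?v + p (l - 1 + l) * ?u"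
    using l by simp
  let ?m = "max ?u ?v"
  have pos: "0 \<le> p 0" "0 \<le> p l" "0 \<le> p (l - 1)" "0 \<le> p (l - 1 + l)"
    using l by (auto intro: p_nonneg)
  have "?u \<le> (p 0 + p l) * ?m"
    by (subst u, subst distrib_right) (intro add_mono mult_left_mono pos, auto)
  moreover have "?v \<le> (p (l - 1) + p (l - 1 + l)) * ?m"
    by (subst v, subst distrib_right) (intro add_mono mult_left_mono pos, auto)
  moreover have "p 0 + p l < 1" "p (l - 1) + p (l - 1 + l) < 1"
    using weight_less_1[of 0] weight_less_1[of "l - 1"] l by auto
  moreover have "c * ?m < ?m" if "c < 1" "0 < ?m" for c
    using that by simp
  ultimately have "\<not> 0 < ?m"
    by (metis max_def not_less)
  then show "?u = 0" "?v = 0"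
    using measure_nonneg[of M "{0}"] measure_nonneg[of M "{1}"] by linarith+
qed

lemma measure_eq_off_endpoints:
  assumes A: "A \<in> sets M" and B: "B \<in> sets M"
    and eq: "\<And>x. 0 < x \<Longrightarrow> x < 1 \<Longrightarrow> x \<in> A \<longleftrightarrow> x \<in> B"
  shows "measure M A = measure M B"
proof (rule finite_measure_eq_AE[OF _ A B])
  have "{0} \<in> null_sets M" "{1} \<in> null_sets M"
    using endpoints_null by (auto simp: null_sets_def in_sets_M emeasure_eq_measure)
  then have "AE x in M. x \<notin> {0}" "AE x in M. x \<notin> {1}"
    by (simp_all only: AE_not_in)
  then show "AE x in M. (x \<in> A) = (x \<in> B)"
  proof eventually_elim
    case (elim x)
    show ?case
    proof (cases "x \<in> {0..1}")
      case True
      then show ?thesis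
        using eq[of x] elim by auto
    next
      case False
      then show ?thesis
        using A B unfolding in_sets_M by blast
    qed
  qed
qed

lemma measure_empty_interior:
  assumes "A \<in> sets M" and "A \<subseteq> {0, 1}"
  shows "measure M A = 0"
  using measure_eq_off_endpoints[of A "{}"] assms by (auto simp: subset_iff)

text \<open>The images of the other branches meet the closed interval in at most an endpoint, which
  does not contribute.\<close>

lemma measure_first_generation:
  assumes A: "A \<in> sets M" and i: "i < l" and sub: "A \<subseteq> closed_ladic l 1 i"
  shows "measure M A = p i * measure M (zoom l 1 i A)
           + p (i + l) * measure M (mirror (zoom l 1 i A))"
proof -
  have other: "zoom l 1 j A \<subseteq> {0, 1}" if "j \<noteq> i" for j
  proof
    fix x assume x: "x \<in> zoom l 1 j A"
    then have "real i \<le> x + real j" "x + real j \<le> real i + 1" "0 \<le> x" "x \<le> 1"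
      using sub l by (auto simp: mem_zoom closed_ladic_def subset_iff divide_le_cancel)
    then have x: "real i \<le> x + real j" "x + real j \<le> real i + 1" "0 \<le> x" "x \<le> 1" .
    show "x \<in> {0, 1}"
    proof (cases "j < i")
      case True
      then have "real j + 1 \<le> real i"
        by linarith
      then show ?thesis
        using x by auto
    next
      case False
      then have "real i + 1 \<le> real j"
        using that by linarith
      then show ?thesis
        using x by auto
    qed
  qed
  have "measure M (zoom l 1 j A) = 0" "measure M (mirror (zoom l 1 j A)) = 0" if "j \<noteq> i" for j
    using other[OF that] A by (auto intro!: measure_empty_interior simp: mem_mirror subset_iff)
  then have "(\<Sum>j<l. p j * measure M (zoom l 1 j A) + p (j + l) * measure M (mirror (zoom l 1 j A)))
     = (\<Sum>j<l. if j = i then p i * measure M (zoom l 1 i A)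
           + p (i + l) * measure M (mirror (zoom l 1 i A)) else 0)"
    by (intro sum.cong) auto
  then show ?thesis
    using i by (subst measure_eq_sum_zoom[OF A]) simp
qed

text \<open>On an interval of generation \<open>n\<close>, the pair of \<open>\<mu>\<close> and its mirror image is a linear image
  of the same pair at unit scale. The last two conclusions record the shape of the matrix, which
  is a product of the matrices of the single digits, in the two degenerate cases.\<close>

lemma cylinder_matrix:
  assumes "k < l ^ n"
  obtains a b c d where
    "0 \<le> a" "0 \<le> b" "0 \<le> c" "0 \<le> d"
    "\<And>A. A \<in> sets M \<Longrightarrow> A \<subseteq> closed_ladic l n k \<Longrightarrow>
       measure M A = a * measure M (zoom l n k A) + b * measure M (mirror (zoom l n k A))"
    "\<And>A. A \<in> sets M \<Longrightarrow> A \<subseteq> closed_ladic l n k \<Longrightarrow>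
       measure M (mirror A) = c * measure M (zoom l n k A) + d * measure M (mirror (zoom l n k A))"
    "\<forall>i<l. p (i + l) = 0 \<Longrightarrow> b = 0 \<and> c = 0"
    "\<forall>i<l. p i = 0 \<and> p (i + l) = p ((l - 1 - i) + l) \<Longrightarrow> a = d \<and> b = c"
  using assms
proof (induction n arbitrary: k thesis)
  case 0
  have "k = 0"
    using 0 by simp
  show ?case
    by (rule "0.prems"(1)[of 1 0 0 1])
      (auto simp: \<open>k = 0\<close> zoom_0_0 closed_ladic_def)
next
  case (Suc n)
  define i where "i = k mod l"
  define i' where "i' = l - 1 - i"
  have l0: "0 < l"
    using l by simp
  have i: "i < l" "i' < l"
    using l0 by (auto simp: i_def i'_def)
  have nonneg: "0 \<le> p i" "0 \<le> p (i + l)" "0 \<le> p i'" "0 \<le> p (i' + l)"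
    using i by (auto intro!: p_nonneg)
  have "k div l < l ^ n"
    using Suc.prems(2) by (simp add: less_mult_imp_div_less mult.commute)
  then obtain a b c d where abcd: "0 \<le> a" "0 \<le> b" "0 \<le> c" "0 \<le> d"
    and ab: "\<And>A. A \<in> sets M \<Longrightarrow> A \<subseteq> closed_ladic l n (k div l) \<Longrightarrow> measure M A
       = a * measure M (zoom l n (k div l) A) + b * measure M (mirror (zoom l n (k div l) A))"
    and cd: "\<And>A. A \<in> sets M \<Longrightarrow> A \<subseteq> closed_ladic l n (k div l) \<Longrightarrow> measure M (mirror A)
       = c * measure M (zoom l n (k div l) A) + d * measure M (mirror (zoom l n (k div l) A))"
    and preserving: "\<forall>i<l. p (i + l) = 0 \<Longrightarrow> b = 0 \<and> c = 0"
    and symmetric: "\<forall>i<l. p i = 0 \<and> p (i + l) = p ((l - 1 - i) + l) \<Longrightarrow> a = d \<and> b = c"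
    using Suc.IH[of "k div l"] by blast
  have step: "measure M A = (a * p i + b * p (i' + l)) * measure M (zoom l (Suc n) k A)
        + (a * p (i + l) + b * p i') * measure M (mirror (zoom l (Suc n) k A))"
      "measure M (mirror A) = (c * p i + d * p (i' + l)) * measure M (zoom l (Suc n) k A)
        + (c * p (i + l) + d * p i') * measure M (mirror (zoom l (Suc n) k A))"
    if A: "A \<in> sets M" "A \<subseteq> closed_ladic l (Suc n) k" for A
  proof -
    let ?B = "zoom l n (k div l) A" and ?D = "zoom l (Suc n) k A"
    have subA: "A \<subseteq> closed_ladic l n (k div l)"
      using closed_ladic_Suc_subset(1)[OF l0] A(2) by blast
    have subB: "?B \<subseteq> closed_ladic l 1 i"
      using closed_ladic_Suc_subset(2)[OF l0 A(2)] by (simp add: i_def)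
    have D: "zoom l 1 i ?B = ?D" "zoom l 1 i' (mirror ?B) = mirror ?D"
      using zoom_Suc[OF l0] zoom_mirror[OF i(1)] by (simp_all add: i_def i'_def)
    have B: "measure M ?B = p i * measure M ?D + p (i + l) * measure M (mirror ?D)"
      using measure_first_generation[OF _ i(1) subB] A(1) D by simp
    have "measure M (mirror ?B) = p i' * measure M (mirror ?D) + p (i' + l) * measure M ?D"
      using measure_first_generation[OF _ i(2), of "mirror ?B"] mirror_closed_ladic[OF i(1) subB]
        A(1) D mirror_mirror[OF zoom_subset]
      by (simp add: i'_def)
    with B ab[OF A(1) subA] cd[OF A(1) subA]
    show "measure M A = (a * p i + b * p (i' + l)) * measure M ?D
        + (a * p (i + l) + b * p i') * measure M (mirror ?D)"
      "measure M (mirror A) = (c * p i + d * p (i' + l)) * measure M ?D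
        + (c * p (i + l) + d * p i') * measure M (mirror ?D)"
      by (simp_all add: algebra_simps)
  qed
  show ?case
  proof (rule Suc.prems(1)[of "a * p i + b * p (i' + l)" "a * p (i + l) + b * p i'"
        "c * p i + d * p (i' + l)" "c * p (i + l) + d * p i'"])
    show "a * p (i + l) + b * p i' = 0 \<and> c * p i + d * p (i' + l) = 0"
      if "\<forall>i<l. p (i + l) = 0"
      using preserving[OF that] that i by simp
    show "a * p i + b * p (i' + l) = c * p (i + l) + d * p i'
        \<and> a * p (i + l) + b * p i' = c * p i + d * p (i' + l)"
      if *: "\<forall>i<l. p i = 0 \<and> p (i + l) = p ((l - 1 - i) + l)"
    proof -
      have "p (i + l) = p (i' + l)" "p i = 0" "p i' = 0"
        using * i unfolding i'_def by blast+
      then show ?thesis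
        using symmetric[OF *] by simp
    qed
  qed (use abcd nonneg step in auto)
qed


section \<open>Intervals and shifts\<close>

text \<open>The total weights \<open>P\<close> and \<open>Q\<close> of the orientation preserving and reversing maps.\<close>

definition preserving_weight :: real where
  "preserving_weight = (\<Sum>i<l. p i)"

definition reversing_weight :: real where
  "reversing_weight = (\<Sum>i<l. p (i + l))"

lemma weights_sum: "preserving_weight + reversing_weight = 1"
  using p_sum by (simp add: preserving_weight_def reversing_weight_def sum_double)

lemma weights_nonneg: "0 \<le> preserving_weight" "0 \<le> reversing_weight"
  by (auto simp: preserving_weight_def reversing_weight_def intro!: sum_nonneg p_nonneg)

lemma weights_eq_0_iff:
  "preserving_weight = 0 \<longleftrightarrow> (\<forall>i<l. p i = 0)"
  "reversing_weight = 0 \<longleftrightarrow> (\<forall>i<l. p (i + l) = 0)"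
  unfolding preserving_weight_def reversing_weight_def
  by (subst sum_nonneg_eq_0_iff; auto intro: p_nonneg)+

lemma measure_shift_preimage:
  assumes A: "A \<in> sets M"
  shows "measure M (shift_preimage l 1 A)
           = preserving_weight * measure M A + reversing_weight * measure M (mirror A)"
    and "measure M (mirror (shift_preimage l 1 A))
           = preserving_weight * measure M (mirror A) + reversing_weight * measure M A"
proof -
  let ?B = "shift_preimage l 1 A"
  have l0: "0 < l"
    using l by simp
  have mem: "x \<in> zoom l 1 i ?B \<longleftrightarrow> x \<in> A" if "0 < x" "x < 1" "i < l" for x i
  proof -
    have "shift l ((x + real i) / real l) = x"
      using that l0 by (simp add: shift_def frac_eq)
    moreover have "0 \<le> (x + real i) / real l \<and> (x + real i) / real l \<le> 1"
      using that by (simp add: field_simps)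
    ultimately show ?thesis
      using that by (simp add: mem_zoom shift_preimage_def)
  qed
  have mem': "x \<in> zoom l 1 i (mirror ?B) \<longleftrightarrow> x \<in> mirror A" if "0 < x" "x < 1" "i < l" for x i
  proof -
    have "zoom l 1 i (mirror ?B) = mirror (zoom l 1 (l - 1 - i) ?B)"
      using zoom_mirror[of "l - 1 - i" l ?B] that by simp
    then show ?thesis
      using that mem[of "1 - x" "l - 1 - i"] by (simp add: mem_mirror)
  qed
  have mm: "mirror (mirror A) = A"
    using A by (simp add: mirror_mirror in_sets_M)
  have main: "measure M B' = preserving_weight * measure M A' + reversing_weight * measure M (mirror A')"
    if B': "B' \<in> sets M" and A': "A' \<in> sets M"
      and mem: "\<And>x i. 0 < x \<Longrightarrow> x < 1 \<Longrightarrow> i < l \<Longrightarrow> x \<in> zoom l 1 i B' \<longleftrightarrow> x \<in> A'" for A' B'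
  proof -
    have "measure M (zoom l 1 i B') = measure M A'"
      "measure M (mirror (zoom l 1 i B')) = measure M (mirror A')" if "i < l" for i
      by (rule measure_eq_off_endpoints; use A' B' that in \<open>simp add: mem mem_mirror del: One_nat_def\<close>)+
    then show ?thesis
      by (simp add: measure_eq_sum_zoom[OF B'] preserving_weight_def reversing_weight_def
          sum.distrib sum_distrib_right)
  qed
  show "measure M ?B = preserving_weight * measure M A + reversing_weight * measure M (mirror A)"
    using A by (intro main) (auto simp: mem simp del: One_nat_def)
  have "measure M (mirror ?B)
      = preserving_weight * measure M (mirror A) + reversing_weight * measure M (mirror (mirror A))"
    using A by (intro main) (auto simp: mem' simp del: One_nat_def)
  then show "measure M (mirror ?B)
      = preserving_weight * measure M (mirror A) + reversing_weight * measure M A"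
    by (simp add: mm)
qed

lemma ladic_in_sets:
  assumes "I \<in> ladic_intervals l n"
  shows "I \<in> sets M"
  using assms ladic_subset_unit[of l _ n] l by (fastforce simp: ladic_intervals_def in_sets_M)

lemma measure_mirror_unit: "measure M {0..1} = 1" "measure M (mirror {0..1}) = 1"
proof -
  have "mirror {0..1} = {0..1}"
    by (auto simp: mirror_def)
  then show "measure M {0..1} = 1" "measure M (mirror {0..1}) = 1"
    using prob_space by (simp_all add: space_M)
qed

text \<open>For an interval \<open>I\<close> of generation \<open>n\<close>, the rescaled copy of \<open>I \<inter> \<sigma>\<^sup>-\<^sup>(\<^sup>n\<^sup>+\<^sup>1\<^sup>) J\<close> is \<open>\<sigma>\<^sup>-\<^sup>1 J\<close>
  up to endpoints, so the fourth conclusion is an instance of \<open>cylinder_matrix\<close>.\<close>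

lemma measure_ladic:
  assumes "I \<in> ladic_intervals l n"
  obtains a b where
    "0 \<le> a" "0 \<le> b" "measure M I = a + b"
    "\<And>J. J \<in> sets M \<Longrightarrow> measure M (I \<inter> shift_preimage l (n + 1) J)
       = a * measure M (shift_preimage l 1 J) + b * measure M (mirror (shift_preimage l 1 J))"
    "\<forall>i<l. p (i + l) = 0 \<Longrightarrow> b = 0"
    "\<forall>i<l. p i = 0 \<and> p (i + l) = p ((l - 1 - i) + l) \<Longrightarrow> measure M (mirror I) = measure M I"
proof -
  obtain k where k: "k < l ^ n" and I: "I = {real k / real l ^ n ..< real (k + 1) / real l ^ n}"
    using assms by (auto simp: ladic_intervals_def)
  have l0: "0 < real l ^ n"
    using l by simp
  have sub: "I \<subseteq> closed_ladic l n k"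
    by (auto simp: I closed_ladic_def add.commute)
  have I_sets: "I \<in> sets M"
    by (rule ladic_in_sets[OF assms])
  obtain a b c d where abcd: "0 \<le> a" "0 \<le> b" "0 \<le> c" "0 \<le> d"
    and ab: "\<And>A. A \<in> sets M \<Longrightarrow> A \<subseteq> closed_ladic l n k \<Longrightarrow>
       measure M A = a * measure M (zoom l n k A) + b * measure M (mirror (zoom l n k A))"
    and cd: "\<And>A. A \<in> sets M \<Longrightarrow> A \<subseteq> closed_ladic l n k \<Longrightarrow>
       measure M (mirror A) = c * measure M (zoom l n k A) + d * measure M (mirror (zoom l n k A))"
    and preserving: "\<forall>i<l. p (i + l) = 0 \<Longrightarrow> b = 0 \<and> c = 0"
    and symmetric: "\<forall>i<l. p i = 0 \<and> p (i + l) = p ((l - 1 - i) + l) \<Longrightarrow> a = d \<and> b = c"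
    using cylinder_matrix[OF k] by blast
  have mem_I: "(x + real k) / real l ^ n \<in> I" if "0 < x" "x < 1" for x
    using that l0 by (simp add: I divide_le_cancel divide_less_cancel)
  have unit: "{0..1} \<in> sets M"
    by (simp add: in_sets_M)
  have zoom_I: "measure M (zoom l n k I) = 1" "measure M (mirror (zoom l n k I)) = 1"
  proof -
    have "measure M (zoom l n k I) = measure M {0..1}"
      "measure M (mirror (zoom l n k I)) = measure M (mirror {0..1})"
      by (rule measure_eq_off_endpoints;
          use I_sets unit in \<open>simp add: mem_mirror mem_zoom mem_I\<close>)+
    then show "measure M (zoom l n k I) = 1" "measure M (mirror (zoom l n k I)) = 1"
      by (simp_all add: measure_mirror_unit)
  qed
  show ?thesis
  proof (rule that[of a b])
    show "0 \<le> a" "0 \<le> b"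
      by (fact abcd)+
    show "measure M I = a + b"
      using ab[OF I_sets sub] by (simp add: zoom_I)
    show "b = 0" if "\<forall>i<l. p (i + l) = 0"
      using preserving[OF that] by simp
    show "measure M (mirror I) = measure M I"
      if "\<forall>i<l. p i = 0 \<and> p (i + l) = p ((l - 1 - i) + l)"
      using symmetric[OF that] ab[OF I_sets sub] cd[OF I_sets sub] by (simp add: zoom_I)
    fix J assume J: "J \<in> sets M"
    let ?A = "I \<inter> shift_preimage l (n + 1) J"
    have A: "?A \<in> sets M"
      using J I_sets by (intro sets.Int) simp_all
    have mem: "x \<in> zoom l n k ?A \<longleftrightarrow> x \<in> shift_preimage l 1 J" if x: "0 < x" "x < 1" for x
    proof -
      have "real l ^ Suc n * ((x + real k) / real l ^ n) = real l * x + real (l * k)"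
        using l0 by (simp add: distrib_left[symmetric])
      then have "(shift l ^^ Suc n) ((x + real k) / real l ^ n) = frac (real l * x + real (l * k))"
        by (simp only: shift_funpow_Suc)
      then have "(shift l ^^ Suc n) ((x + real k) / real l ^ n) = shift l x"
        by (simp only: frac_add_of_nat shift_def)
      moreover have "(x + real k) / real l ^ n \<in> {0..1}"
        using mem_I[OF x] I_sets by (auto simp: in_sets_M)
      ultimately show ?thesis
        using x mem_I[OF x] by (simp add: mem_zoom shift_preimage_def del: funpow.simps) simp
    qed
    have "measure M (zoom l n k ?A) = measure M (shift_preimage l 1 J)"
      "measure M (mirror (zoom l n k ?A)) = measure M (mirror (shift_preimage l 1 J))"
      by (rule measure_eq_off_endpoints; use A J in \<open>simp add: mem_mirror mem del: One_nat_def add_Suc_right add_0_right\<close>)+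
    moreover have "?A \<subseteq> closed_ladic l n k"
      using sub by blast
    ultimately show "measure M ?A = a * measure M (shift_preimage l 1 J)
        + b * measure M (mirror (shift_preimage l 1 J))"
      using ab[OF A] by simp
  qed
qed

text \<open>The case distinction on the vanishing of \<open>P\<close> and \<open>Q\<close>; \<open>u\<close> and \<open>v\<close> denote the measures of
  \<open>J\<close> and of its mirror image.\<close>

lemma quasi_bernoulli_constant:
  assumes orientation: "(\<exists>i<l. 0 < p i) \<or> (\<forall>i<l. p (i + l) = p ((l - 1 - i) + l))"
  obtains C where "0 < C"
    "\<And>n m I J. I \<in> ladic_intervals l n \<Longrightarrow> J \<in> ladic_intervals l m \<Longrightarrow>
       inverse C * measure M I * measure M J \<le> measure M (I \<inter> shift_preimage l (n + 1) J) \<and>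
       measure M (I \<inter> shift_preimage l (n + 1) J)
         \<le> C * measure M I * measure M (shift_preimage l 2 J)"
proof -
  define P Q where PQ_def: "P = preserving_weight" "Q = reversing_weight"
  have PQ: "0 \<le> P" "0 \<le> Q" "P + Q = 1"
    using weights_nonneg weights_sum by (simp_all add: PQ_def)
  define C where "C = (if P = 0 \<or> Q = 0 then 1 else 1 / (P * Q))"
  have "0 < C"
    using PQ by (simp add: C_def)
  moreover have "inverse C * measure M I * measure M J \<le> measure M (I \<inter> shift_preimage l (n + 1) J) \<and>
       measure M (I \<inter> shift_preimage l (n + 1) J)
         \<le> C * measure M I * measure M (shift_preimage l 2 J)" (is "?lower \<and> ?upper")
    if I: "I \<in> ladic_intervals l n" and J: "J \<in> ladic_intervals l m" for n m I J
  proof -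
    have J_sets: "J \<in> sets M"
      by (rule ladic_in_sets[OF J])
    obtain a b where ab: "0 \<le> a" "0 \<le> b" "measure M I = a + b"
      and inter: "measure M (I \<inter> shift_preimage l (n + 1) J)
       = a * measure M (shift_preimage l 1 J) + b * measure M (mirror (shift_preimage l 1 J))"
      and b0: "\<forall>i<l. p (i + l) = 0 \<Longrightarrow> b = 0"
      using measure_ladic[OF I] J_sets by metis
    define u v where uv_def: "u = measure M J" "v = measure M (mirror J)"
    have uv: "0 \<le> u" "0 \<le> v"
      by (simp_all add: uv_def)
    have inter: "measure M (I \<inter> shift_preimage l (n + 1) J)
        = a * (P * u + Q * v) + b * (P * v + Q * u)"
      unfolding inter by (simp only: measure_shift_preimage[OF J_sets] PQ_def uv_def)
    have two: "measure M (shift_preimage l 2 J) = P * (P * u + Q * v) + Q * (P * v + Q * u)"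
      using measure_shift_preimage[of "shift_preimage l 1 J"] J_sets
      by (simp add: shift_preimage_2 measure_shift_preimage PQ_def uv_def del: One_nat_def)
    consider "Q = 0" | "P = 0" | "0 < P" "0 < Q"
      using PQ by linarith
    then show ?thesis
    proof cases
      case 1
      then have "b = 0" "P = 1"
        using b0 PQ weights_eq_0_iff by (simp_all add: PQ_def)
      then show ?thesis
        using 1 inter two ab by (simp add: C_def uv_def)
    next
      case 2
      then have "\<forall>i<l. p i = 0"
        using weights_eq_0_iff by (simp add: PQ_def)
      with orientation have "\<forall>i<l. p i = 0 \<and> p (i + l) = p ((l - 1 - i) + l)"
        by auto
      then have "v = u"
        using measure_ladic[OF J] by (metis uv_def)
      then show ?thesis
        using 2 PQ inter two ab by (simp add: C_def uv_def algebra_simps)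
    next
      case 3
      have C: "C = 1 / (P * Q)"
        using 3 by (simp add: C_def)
      have le: "P \<le> 1" "Q \<le> 1"
        using PQ by linarith+
      have PQ_le: "P * Q \<le> P" "P * Q \<le> Q"
        using PQ le by (simp_all add: mult_left_le mult_left_le_one_le)
      have "P * Q * u \<le> P * u + Q * v" "P * Q * u \<le> P * v + Q * u"
        using mult_right_mono[OF PQ_le(1) uv(1)] mult_right_mono[OF PQ_le(2) uv(1)] PQ uv
        by (simp_all add: add_increasing2 add_increasing)
      then have "a * (P * Q * u) + b * (P * Q * u) \<le> a * (P * u + Q * v) + b * (P * v + Q * u)"
        using ab by (intro add_mono mult_left_mono)
      then have lower: ?lower
        unfolding inter by (simp add: C ab(3) uv_def algebra_simps)
      have "P * u + Q * v \<le> u + v" "P * v + Q * u \<le> u + v"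
        using mult_right_mono[OF le(1) uv(1)] mult_right_mono[OF le(2) uv(2)]
          mult_right_mono[OF le(1) uv(2)] mult_right_mono[OF le(2) uv(1)] by linarith+
      then have "a * (P * u + Q * v) + b * (P * v + Q * u) \<le> a * (u + v) + b * (u + v)"
        using ab by (auto intro!: add_mono[of "a * _" "a * _"]
            mult_left_mono[of _ _ a] mult_left_mono[of _ _ b])
      also have "\<dots> = (a + b) * (u + v)"
        by (simp add: algebra_simps)
      also have "\<dots> \<le> (a + b) * (C * measure M (shift_preimage l 2 J))"
      proof (rule mult_left_mono)
        have "P * Q \<le> P * P + Q * Q"
          using sum_squares_bound[of P Q] mult_nonneg_nonneg[OF PQ(1,2)]
          unfolding power2_eq_square mult.assoc by linarith
        then have "P * Q * u \<le> (P * P + Q * Q) * u"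
          using uv by (intro mult_right_mono)
        moreover have "0 \<le> P * Q * v"
          using PQ uv by simp
        ultimately have "P * Q * (u + v) \<le> measure M (shift_preimage l 2 J)"
          unfolding two by (simp add: algebra_simps)
        then show "u + v \<le> C * measure M (shift_preimage l 2 J)"
          using 3 by (simp add: C field_simps)
      qed (use ab in simp)
      finally have ?upper
        unfolding inter by (simp add: ab(3) mult_ac)
      with lower show ?thesis ..
    qed
  qed
  ultimately show ?thesis
    by (rule that)
qed

end


section \<open>The quasi-Bernoulli bounds\<close>

(* The assumption "orientation" excludes exactly the weights for which the two-sided bound fails:
   if all maps with positive weight reverse orientation, then for even n the measure of
   I \<inter> shift_preimage l (n + 1) J is M(I) times the measure of the mirror image of J, which is
   comparable to M(J) uniformly in J only if the weights are symmetric. *)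
theorem proposition2p1:
  fixes l :: nat and p :: "nat \<Rightarrow> real" and M :: "real measure"
  assumes l: "2 \<le> l"
    and p_nonneg: "\<forall>i<2 * l. 0 \<le> p i"
    and p_sum: "(\<Sum>i<2 * l. p i) = 1"
    and p_pos: "\<forall>i<l. 0 < p i + p (i + l)"
    and orientation: "(\<exists>i<l. 0 < p i) \<or> (\<forall>i<l. p (i + l) = p ((l - 1 - i) + l))"
    and M: "self_similar_measure l p M"
  shows "\<exists>C>0. \<forall>n m. \<forall>I \<in> ladic_intervals l n. \<forall>J \<in> ladic_intervals l m.
           inverse C * measure M I * measure M J
             \<le> measure M (I \<inter> shift_preimage l (n + 1) J) \<and>
           measure M (I \<inter> shift_preimage l (n + 1) J)
             \<le> C * measure M I * measure M (shift_preimage l 2 J)"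
proof -
  interpret ladic_self_similar l p M
    using l p_nonneg p_sum p_pos M by unfold_locales auto
  obtain C where "0 < C" and
    "\<And>n m I J. I \<in> ladic_intervals l n \<Longrightarrow> J \<in> ladic_intervals l m \<Longrightarrow>
       inverse C * measure M I * measure M J \<le> measure M (I \<inter> shift_preimage l (n + 1) J) \<and>
       measure M (I \<inter> shift_preimage l (n + 1) J)
         \<le> C * measure M I * measure M (shift_preimage l 2 J)"
    using quasi_bernoulli_constant[OF orientation] by blast
  then show ?thesis
    by blast
qed

end
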